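(* Let $(X,F)$ be a CR-dynamical system. If $(X,F)$ has the initial specification property, then $(X,F)$ has the specification property.
   Context: A CR-dynamical system is a pair $(X,F)$ where $X$ is a non-empty compact metric space with metric $d$ and $F\subseteq X\times X$ is closed in $X\times X$. Notation: $F(x)=\{y:(x,y)\in F\}$, $F(A)=\bigcup_{a\in A}F(a)$, $F^0(x)=\{x\}$, $F^{k+1}(x)=F(F^k(x))$. For non-empty $A,B\subseteq X$, $d(A,B)=\inf\{d(a,b):a\in A,b\in B\}$; an inequality $d(A,B)\le\varepsilon$ is understood to hold only if $A,B$ are non-empty. Write $F^{[k,\ell]}(x)=(F^k(x),\ldots,F^\ell(x))$. A specification in $(X,F)$ is a tuple $\mathcal S=(F^{[k_1,\ell_1]}(x_1),\ldots,F^{[k_n,\ell_n]}(x_n))$ with $n\ge1$, $x_j\in X$, integers $0\le k_j\le\ell_j$ (these data being part of $\mathcal S$); for a positive integer $N$ it is $N$-spaced if $k_{j+1}-\ell_j\ge N$ for $1\le j\le n-1$. An $N$-spaced specification $\mathcal S$ is $\varepsilon$-traced in $(X,F)$ by $y\in X$ if $d(F^j(y),F^j(x_i))\le\varepsilon$ for all $i\in\{1,\ldots,n\}$ and $j\in\{k_i,\ldots,\ell_i\}$. $(X,F)$ has the specification property if for each $\varepsilon>0$ there is a positive integer $N$ such that every $N$-spaced specification in $(X,F)$ is $\varepsilon$-traced in $(X,F)$ by some $y\in X$. An initial $n$-specification in $(X,F)$ is a specification $(F^{[0,\ell_1]}(x_1),\ldots,F^{[0,\ell_n]}(x_n))$.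 For positive integers $m_1,\ldots,m_{n-1}$, it is $(\varepsilon,m_1,\ldots,m_{n-1})$-traced in $(X,F)$ by $y\in X$ if, with $s_i=\sum_{r=1}^{i-1}(\ell_r+m_r)$, $d(F^{s_i+j}(y),F^j(x_i))\le\varepsilon$ for all $i\in\{1,\ldots,n\}$ and $j\in\{0,\ldots,\ell_i\}$. $(X,F)$ has the initial specification property if for each $\varepsilon>0$ there is a positive integer $N$ such that for each positive integer $n$, all integers $m_1,\ldots,m_{n-1}\ge N$ and every initial $n$-specification $\mathcal S$ in $(X,F)$, there is $y\in X$ such that $\mathcal S$ is $(\varepsilon,m_1,\ldots,m_{n-1})$-traced in $(X,F)$ by $y$. *)

theory Defs
  imports "HOL-Analysis.Analysis"
begin

definition CR_dynamical_system :: "'a::metric_space set \<Rightarrow> ('a \<times> 'a) set \<Rightarrow> bool" where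
  "CR_dynamical_system X F \<longleftrightarrow>
     X \<noteq> {} \<and> compact X \<and> closedin (top_of_set (X \<times> X)) F"

(* iter F k x is F^k(x), with F(A) = F `` A. *)
primrec iter :: "('a \<times> 'a) set \<Rightarrow> nat \<Rightarrow> 'a \<Rightarrow> 'a set" where
  "iter F 0 x = {x}"
| "iter F (Suc k) x = F `` iter F k x"

(* The inequality d(A,B) <= \<epsilon>. As setdist is 0 when an argument is empty, the
   non-emptiness on which the inequality is conditional is stated explicitly. *)
definition setdist_le :: "'a::metric_space set \<Rightarrow> 'a set \<Rightarrow> real \<Rightarrow> bool" where
  "setdist_le A B \<epsilon> \<longleftrightarrow> A \<noteq> {} \<and> B \<noteq> {} \<and> setdist A B \<le> \<epsilon>"

(* The specification (F^[k 1, l 1](x 1), ..., F^[k n, l n](x n)) is represented by its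
   data n, k, l, x; values of k, l, x outside {1..n} are irrelevant. *)
definition specification_in ::
    "'a set \<Rightarrow> nat \<Rightarrow> (nat \<Rightarrow> nat) \<Rightarrow> (nat \<Rightarrow> nat) \<Rightarrow> (nat \<Rightarrow> 'a) \<Rightarrow> bool" where
  "specification_in X n k l x \<longleftrightarrow> n \<ge> 1 \<and> (\<forall>j\<in>{1..n}. x j \<in> X \<and> k j \<le> l j)"

(* k (j+1) - l j >= N, written without truncated subtraction. *)
definition spaced :: "nat \<Rightarrow> nat \<Rightarrow> (nat \<Rightarrow> nat) \<Rightarrow> (nat \<Rightarrow> nat) \<Rightarrow> bool" where
  "spaced N n k l \<longleftrightarrow> (\<forall>j\<in>{1..<n}. k (j + 1) \<ge> l j + N)"

definition traced ::
    "('a::metric_space \<times> 'a) set \<Rightarrow> real \<Rightarrow>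
     nat \<Rightarrow> (nat \<Rightarrow> nat) \<Rightarrow> (nat \<Rightarrow> nat) \<Rightarrow> (nat \<Rightarrow> 'a) \<Rightarrow> 'a \<Rightarrow> bool" where
  "traced F \<epsilon> n k l x y \<longleftrightarrow>
     (\<forall>i\<in>{1..n}. \<forall>j\<in>{k i..l i}. setdist_le (iter F j y) (iter F j (x i)) \<epsilon>)"

definition specification_property :: "'a::metric_space set \<Rightarrow> ('a \<times> 'a) set \<Rightarrow> bool" where
  "specification_property X F \<longleftrightarrow>
     (\<forall>\<epsilon>>0. \<exists>N>0. \<forall>n k l x.
        specification_in X n k l x \<longrightarrow> spaced N n k l \<longrightarrow> (\<exists>y\<in>X. traced F \<epsilon> n k l x y))"

definition initial_specification_in ::
    "'a set \<Rightarrow> nat \<Rightarrow> (nat \<Rightarrow> nat) \<Rightarrow> (nat \<Rightarrow> 'a) \<Rightarrow> bool" where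
  "initial_specification_in X n l x \<longleftrightarrow> specification_in X n (\<lambda>_. 0) l x"

(* Only the gaps m 1, ..., m (n-1) are relevant. *)
definition initial_traced ::
    "('a::metric_space \<times> 'a) set \<Rightarrow> real \<Rightarrow> (nat \<Rightarrow> nat) \<Rightarrow>
     nat \<Rightarrow> (nat \<Rightarrow> nat) \<Rightarrow> (nat \<Rightarrow> 'a) \<Rightarrow> 'a \<Rightarrow> bool" where
  "initial_traced F \<epsilon> m n l x y \<longleftrightarrow>
     (\<forall>i\<in>{1..n}. \<forall>j\<in>{0..l i}.
        setdist_le (iter F ((\<Sum>r\<in>{1..<i}. l r + m r) + j) y) (iter F j (x i)) \<epsilon>)"

definition initial_specification_property ::
    "'a::metric_space set \<Rightarrow> ('a \<times> 'a) set \<Rightarrow> bool" where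
  "initial_specification_property X F \<longleftrightarrow>
     (\<forall>\<epsilon>>0. \<exists>N>0. \<forall>n\<ge>1. \<forall>m l x.
        (\<forall>i\<in>{1..<n}. m i \<ge> N) \<longrightarrow> initial_specification_in X n l x \<longrightarrow>
        (\<exists>y\<in>X. initial_traced F \<epsilon> m n l x y))"

end

theory Submission
  imports Defs
begin

text \<open>
  The initial specification property makes every \<open>F\<^sup>k(x)\<close> non-empty (trace a single segment of
  length \<open>k\<close>). A segment \<open>F\<^sup>[\<^sup>k\<^sup>,\<^sup>\<ell>\<^sup>](x)\<close> is therefore traced as soon as the initial segment of
  length \<open>\<ell> - k\<close> of some \<open>z \<in> F\<^sup>k(x)\<close> is, since \<open>F\<^sup>j(z) \<subseteq> F\<^sup>k\<^sup>+\<^sup>j(x)\<close>. With \<open>m\<^sub>i = k\<^sub>i\<^sub>+\<^sub>1 - \<ell>\<^sub>i\<close> the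
  \<open>i\<close>-th such segment starts at time \<open>k\<^sub>i\<close> provided \<open>k\<^sub>1 = 0\<close>, which can be achieved by
  prolonging the first segment to the left.
\<close>

lemma iter_add_subset:
  assumes "z \<in> iter F k x"
  shows "iter F j z \<subseteq> iter F (k + j) x"
  by (induction j) (use assms in auto)

lemma iter_in_space:
  assumes "F \<subseteq> X \<times> X" "x \<in> X"
  shows "iter F k x \<subseteq> X"
  by (induction k) (use assms in auto)

lemma setdist_le_mono_right:
  assumes "setdist_le A B \<epsilon>" "B \<subseteq> C"
  shows "setdist_le A C \<epsilon>"
  using assms setdist_subset_right[of B C A] unfolding setdist_le_def by fastforce

lemma iter_nonempty:
  assumes "initial_specification_property X F" "x \<in> X"
  shows "iter F k x \<noteq> {}"
proof -
  obtain N where N: "\<And>n m l x. \<lbrakk>n \<ge> 1; \<forall>i\<in>{1..<n}. m i \<ge> N; initial_specification_in X n l x\<rbrakk>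
      \<Longrightarrow> \<exists>y\<in>X. initial_traced F 1 m n l x y"
    using assms(1) zero_less_one unfolding initial_specification_property_def by meson
  \<comment> \<open>A single segment has no gaps to satisfy. Tracing it at its endpoint
    \<open>j = k\<close>, with any tolerance, already entails that \<open>iter F k x\<close> is
    non-empty.\<close>
  obtain y where "initial_traced F 1 (\<lambda>_. N) 1 (\<lambda>_. k) (\<lambda>_. x) y"
    using N[of 1 "\<lambda>_. N" "\<lambda>_. k" "\<lambda>_. x"] assms(2)
    by (auto simp: initial_specification_in_def specification_in_def)
  then show ?thesis
    by (force simp: initial_traced_def setdist_le_def)
qed

text \<open>The sum telescopes to \<open>k i - k 1\<close>, since
  \<open>k r \<le> l r \<le> k (r + 1)\<close> makes both truncated differences exact.\<close>

lemma sum_lengths_gaps: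
  fixes k l :: "nat \<Rightarrow> nat"
  assumes "k 1 = 0" "specification_in X n k l x" "spaced N n k l" "i \<in> {1..n}"
  shows "(\<Sum>r\<in>{1..<i}. (l r - k r) + (k (r + 1) - l r)) = k i"
proof -
  have "i \<le> n \<longrightarrow> (\<Sum>r\<in>{1..<i}. (l r - k r) + (k (r + 1) - l r)) = k i"
    if "1 \<le> i" for i
    using that
  proof (induction i rule: dec_induct)
    case base
    then show ?case using assms(1) by simp
  next
    case (step i)
    show ?case
    proof
      assume "Suc i \<le> n"
      then have "k i \<le> l i" "l i \<le> k (i + 1)"
        using step.hyps assms(2,3) by (auto simp: specification_in_def spaced_def dest: add_leD1)
      then show "(\<Sum>r\<in>{1..<Suc i}. (l r - k r) + (k (r + 1) - l r)) = k (Suc i)"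
        using step \<open>Suc i \<le> n\<close> by simp
    qed
  qed
  then show ?thesis using assms(4) by simp
qed

lemma traced_if_initial_traced:
  assumes "k 1 = 0" "specification_in X n k l x" "spaced N n k l"
    and z: "\<And>i. i \<in> {1..n} \<Longrightarrow> z i \<in> iter F (k i) (x i)"
    and y: "initial_traced F \<epsilon> (\<lambda>i. k (i + 1) - l i) n (\<lambda>i. l i - k i) z y"
  shows "traced F \<epsilon> n k l x y"
  unfolding traced_def
proof (intro ballI)
  fix i j assume i: "i \<in> {1..n}" and j: "j \<in> {k i..l i}"
  \<comment> \<open>The accumulated offset of segment \<open>i\<close> is \<open>k i\<close>, so its
    index \<open>j - k i\<close> falls on time \<open>j\<close> for \<open>y\<close>.\<close>
  then have "setdist_le (iter F (k i + (j - k i)) y) (iter F (j - k i) (z i)) \<epsilon>"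
    using y[unfolded initial_traced_def, rule_format, of i "j - k i"]
      sum_lengths_gaps[OF assms(1-3) i] by (simp add: diff_le_mono)
  then show "setdist_le (iter F j y) (iter F j (x i)) \<epsilon>"
    using setdist_le_mono_right iter_add_subset[OF z[OF i], of "j - k i"] j by fastforce
qed

theorem theorem6p6:
  fixes X :: "'a::metric_space set" and F :: "('a \<times> 'a) set"
  assumes "CR_dynamical_system X F"
    and "initial_specification_property X F"
  shows "specification_property X F"
  unfolding specification_property_def
proof (intro allI impI)
  fix \<epsilon> :: real assume "\<epsilon> > 0"
  then obtain N where "N > 0" and
    N: "\<And>n m l x. \<lbrakk>n \<ge> 1; \<forall>i\<in>{1..<n}. m i \<ge> N; initial_specification_in X n l x\<rbrakk>
      \<Longrightarrow> \<exists>y\<in>X. initial_traced F \<epsilon> m n l x y"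
    using assms(2) unfolding initial_specification_property_def by meson
  have F: "F \<subseteq> X \<times> X"
    using assms(1) closedin_imp_subset unfolding CR_dynamical_system_def by blast
  have "\<exists>y\<in>X. traced F \<epsilon> n k l x y"
    if spec: "specification_in X n k l x" and spaced: "spaced N n k l" for n k l x
  proof -
    \<comment> \<open>Moving the first start to 0 keeps the spacing: among the start times,
      \<open>spaced\<close> constrains only \<open>k 2, ..., k n\<close>.\<close>
    define k' where "k' = k(1 := 0)"
    have "k' 1 = 0"
      by (simp add: k'_def)
    have spec': "specification_in X n k' l x"
      using spec by (auto simp: k'_def specification_in_def)
    have spaced': "spaced N n k' l"
      using spaced by (auto simp: k'_def spaced_def)
    have "\<exists>z. z \<in> iter F (k' i) (x i)" if "i \<in> {1..n}" for i
      using iter_nonempty[OF assms(2)] spec that by (auto simp: specification_in_def ex_in_conv)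
    then obtain z where z: "\<And>i. i \<in> {1..n} \<Longrightarrow> z i \<in> iter F (k' i) (x i)"
      by metis
    have "z i \<in> X" if "i \<in> {1..n}" for i
      using z[OF that] iter_in_space[OF F, of "x i"] spec that
      by (auto simp: specification_in_def)
    then have "initial_specification_in X n (\<lambda>i. l i - k' i) z"
      using spec by (simp add: initial_specification_in_def specification_in_def)
    moreover have "\<forall>i\<in>{1..<n}. k' (i + 1) - l i \<ge> N"
      using spaced' by (auto simp: spaced_def add.commute intro: add_le_imp_le_diff)
    ultimately obtain y where "y \<in> X"
      and "initial_traced F \<epsilon> (\<lambda>i. k' (i + 1) - l i) n (\<lambda>i. l i - k' i) z y"
      using N[of n "\<lambda>i. k' (i + 1) - l i" "\<lambda>i. l i - k' i" z] spec
      by (auto simp: specification_in_def)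
    then have "traced F \<epsilon> n k' l x y"
      using traced_if_initial_traced[OF \<open>k' 1 = 0\<close> spec' spaced' z] by blast
    \<comment> \<open>Since \<open>k' i \<le> k i\<close>, every time to be traced for
      \<open>k\<close> is also one for \<open>k'\<close>.\<close>
    then have "traced F \<epsilon> n k l x y"
      unfolding traced_def k'_def by (auto split: if_splits)
    with \<open>y \<in> X\<close> show ?thesis by blast
  qed
  with \<open>N > 0\<close> show "\<exists>N>0. \<forall>n k l x. specification_in X n k l x \<longrightarrow> spaced N n k l \<longrightarrow>
      (\<exists>y\<in>X. traced F \<epsilon> n k l x y)"
    by blast
qed

end
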